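(* Let $G_1,\ldots,G_m$ be finite connected graphs, let $G$ be a subgraph (with at least one vertex) of the Cartesian product $G_1\square\cdots\square G_m$, and let $\beta:=\lceil\max\{\mathrm{mad}(G_1),\ldots,\mathrm{mad}(G_m)\}\rceil$ and $\beta_0:=\lceil\max\{\mathrm{mad}(\pi_1(G)),\ldots,\mathrm{mad}(\pi_m(G))\}\rceil$. Then $$\frac{|E(G)|}{|V(G)|}\le \beta_0\log|V(G)|\le \beta\log|V(G)|.$$
   Context: All graphs are finite, simple and undirected; $\log$ denotes the logarithm in base 2. The Cartesian product $G_1\square\cdots\square G_m$ has vertex set $V(G_1)\times\cdots\times V(G_m)$, two tuples $x,y$ being adjacent iff there is an index $j$ with $x_jy_j\in E(G_j)$ and $x_i=y_i$ for all $i\neq j$. For a graph $F$, $\mathrm{mad}(F)$ is the maximum of $2|E(F')|/|V(F')|$ over all subgraphs $F'$ of $F$. For a subgraph $G$ of the product, $\pi_i(G)$ denotes the subgraph of $G_i$ induced by the set $\{x_i : (x_1,\ldots,x_m)\in V(G)\}$ of $i$-th coordinates of vertices of $G$. *)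

theory Defs
  imports Complex_Main "HOL-Library.FuncSet"
begin

datatype 'a ugraph = Graph (verts: "'a set") (edges: "'a set set")

definition simple_graph :: "'a ugraph \<Rightarrow> bool" where
  "simple_graph G \<longleftrightarrow> finite (verts G) \<and> (\<forall>e\<in>edges G. e \<subseteq> verts G \<and> card e = 2)"

definition connected_graph :: "'a ugraph \<Rightarrow> bool" where
  "connected_graph G \<longleftrightarrow> verts G \<noteq> {} \<and>
     (\<forall>u\<in>verts G. \<forall>v\<in>verts G. (u, v) \<in> {(x, y). {x, y} \<in> edges G}\<^sup>*)"

definition subgraph :: "'a ugraph \<Rightarrow> 'a ugraph \<Rightarrow> bool" where
  "subgraph H G \<longleftrightarrow> simple_graph H \<and> verts H \<subseteq> verts G \<and> edges H \<subseteq> edges G"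

definition induced_subgraph :: "'a ugraph \<Rightarrow> 'a set \<Rightarrow> 'a ugraph" where
  "induced_subgraph G S = Graph (verts G \<inter> S) {e \<in> edges G. e \<subseteq> S}"

text \<open>Only subgraphs with at least one vertex are considered, so that the quotient makes sense.
  For a finite graph with a vertex the set below is finite and nonempty.\<close>

definition mad :: "'a ugraph \<Rightarrow> real" where
  "mad F = Max {2 * real (card (edges H)) / real (card (verts H)) |H.
                  subgraph H F \<and> verts H \<noteq> {}}"

text \<open>A tuple indexed by \<open>I\<close> is an extensional function on \<open>I\<close>. All factors have vertices in one
  type; this loses no generality, as finitely many finite graphs can be relabelled.\<close>

definition cartesian_product :: "'i set \<Rightarrow> ('i \<Rightarrow> 'a ugraph) \<Rightarrow> ('i \<Rightarrow> 'a) ugraph" where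
  "cartesian_product I Gs =
     (let V = (\<Pi>\<^sub>E i\<in>I. verts (Gs i)) in
      Graph V {{x, y} |x y. x \<in> V \<and> y \<in> V \<and>
        (\<exists>j\<in>I. {x j, y j} \<in> edges (Gs j) \<and> (\<forall>i\<in>I. i \<noteq> j \<longrightarrow> x i = y i))})"

definition projection :: "('i \<Rightarrow> 'a ugraph) \<Rightarrow> 'i \<Rightarrow> ('i \<Rightarrow> 'a) ugraph \<Rightarrow> 'a ugraph" where
  "projection Gs i G = induced_subgraph (Gs i) ((\<lambda>x. x i) ` verts G)"

end

(* Split the vertex set along a coordinate i taking at least two values, into fibres of sizes n_a.
   Edges in direction i between the fibres over a and b form a matching, so there are at most
   min (n_a) (n_b) of them. A set S of values spans at most \<beta> |S| / 2 edges, and none if |S| = 1,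
   hence at most \<beta> (|S| - 1); summing this over the level sets {a. n_a \<ge> t} bounds the number of
   crossing edges by \<beta> (n - N), where n = |V(G)| and N is the size of the largest fibre.
   Every other fibre has size at most n/2, so n log n - (\<Sum>a. n_a log n_a) \<ge> n - N, and induction
   on n closes the argument. *)

theory Submission
  imports Defs
begin

section \<open>Finite graphs, subgraphs and maximum average degree\<close>

lemma finite_edges:
  assumes "simple_graph G"
  shows "finite (edges G)"
proof (rule finite_subset)
  show "edges G \<subseteq> Pow (verts G)" "finite (Pow (verts G))"
    using assms by (auto simp: simple_graph_def)
qed

lemma subgraph_refl: "simple_graph G \<Longrightarrow> subgraph G G"
  by (simp add: subgraph_def)

lemma subgraph_trans: "subgraph H K \<Longrightarrow> subgraph K G \<Longrightarrow> subgraph H G"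
  by (auto simp: subgraph_def)

lemma verts_induced_subgraph [simp]: "verts (induced_subgraph G S) = verts G \<inter> S"
  by (simp add: induced_subgraph_def)

lemma edges_induced_subgraph [simp]: "edges (induced_subgraph G S) = {e \<in> edges G. e \<subseteq> S}"
  by (simp add: induced_subgraph_def)

lemma subgraph_induced_subgraph:
  assumes "simple_graph G"
  shows "subgraph (induced_subgraph G S) G"
  using assms by (auto simp: subgraph_def simple_graph_def)

text \<open>Every \<open>Max\<close> bound on \<open>mad\<close> needs this finiteness. The quotient
  depends only on the pair of vertex and edge sets, and only finitely many such pairs lie inside
  \<open>G\<close>.\<close>

lemma finite_mad_set:
  assumes "simple_graph G"
  shows "finite {2 * real (card (edges H)) / real (card (verts H)) |H.
           subgraph H G \<and> verts H \<noteq> {}}" (is "finite ?A")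
proof -
  have "finite ((\<lambda>(V, E). 2 * real (card E) / real (card V)) ` (Pow (verts G) \<times> Pow (edges G)))"
    using assms finite_edges[OF assms] by (simp add: simple_graph_def)
  moreover have "?A \<subseteq> (\<lambda>(V, E). 2 * real (card E) / real (card V)) `
      (Pow (verts G) \<times> Pow (edges G))"
    by (force simp: subgraph_def)
  ultimately show ?thesis by (rule rev_finite_subset)
qed

lemma density_le_mad:
  assumes "simple_graph G" "subgraph H G" "verts H \<noteq> {}"
  shows "2 * real (card (edges H)) / real (card (verts H)) \<le> mad G"
  unfolding mad_def using assms by (intro Max_ge finite_mad_set) auto

lemma mad_nonneg:
  assumes "simple_graph G" "verts G \<noteq> {}"
  shows "0 \<le> mad G"
  by (rule order_trans[OF _ density_le_mad[OF assms(1) subgraph_refl[OF assms(1)] assms(2)]]) simp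

lemma mad_mono:
  assumes "simple_graph G" "subgraph H G" "verts H \<noteq> {}"
  shows "mad H \<le> mad G"
proof -
  have H: "simple_graph H" using assms(2) by (simp add: subgraph_def)
  show ?thesis
    unfolding mad_def[of H]
  proof (rule Max.boundedI[OF finite_mad_set[OF H]])
    show "{2 * real (card (edges K)) / real (card (verts K)) |K. subgraph K H \<and> verts K \<noteq> {}} \<noteq> {}"
      using subgraph_refl[OF H] assms(3) by blast
  qed (use density_le_mad[OF assms(1)] subgraph_trans[OF _ assms(2)] in blast)
qed

text \<open>The factor \<open>card S - 1\<close> replaces the usual \<open>card S / 2\<close> so
  that summing over the levels subtracts 1 at each level, which in total is the size of the largest
  fibre. The price is a factor of at most 2, since k/2 \<le> k - 1 for k \<ge> 2; a singleton spans
  no edge.\<close>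

lemma card_induced_edges_le:
  assumes G: "simple_graph G" and S: "S \<subseteq> verts G" "S \<noteq> {}"
  shows "real (card {e \<in> edges G. e \<subseteq> S}) \<le> mad G * (real (card S) - 1)"
proof (cases "card S = 1")
  case True
  then obtain v where "S = {v}" by (rule card_1_singletonE)
  then have none: "{e \<in> edges G. e \<subseteq> S} = {}"
    using G by (auto simp: simple_graph_def subset_singleton_iff)
  show ?thesis unfolding none using True by simp
next
  case False
  have fin: "finite S" using G S by (auto simp: simple_graph_def intro: finite_subset)
  with S have "card S > 0" by auto
  with False have two: "real (card S) \<ge> 2" by simp
  have "verts G \<inter> S = S" using S by auto
  then have "2 * real (card {e \<in> edges G. e \<subseteq> S}) / real (card S) \<le> mad G"
    using density_le_mad[OF G subgraph_induced_subgraph[OF G, of S]] S by simp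
  then have "2 * real (card {e \<in> edges G. e \<subseteq> S}) \<le> mad G * real (card S)"
    using two by (simp add: field_simps)
  moreover have "0 \<le> mad G" using mad_nonneg[OF G] S by auto
  then have "mad G * real (card S) \<le> mad G * (2 * (real (card S) - 1))"
    using two by (intro mult_left_mono) auto
  ultimately show ?thesis by (simp add: algebra_simps)
qed

section \<open>Two inequalities for a family of fibre sizes\<close>

text \<open>For nonempty \<open>f\<close> the inner cardinality is the minimum of \<open>n\<close>
  over \<open>f\<close>, written as a number of thresholds \<open>t\<close> so that the double sum
  can be exchanged. A threshold then sees exactly the members of \<open>F\<close> inside its level
  set, to which \<open>sparse\<close> applies.\<close>

lemma sum_levels_le:
  fixes n :: "'a \<Rightarrow> nat" and b :: real
  assumes A: "finite A" "a\<^sub>0 \<in> A" and F: "finite F" "\<And>f. f \<in> F \<Longrightarrow> f \<subseteq> A"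
    and max: "\<And>a. a \<in> A \<Longrightarrow> n a \<le> n a\<^sub>0"
    and sparse: "\<And>S. S \<subseteq> A \<Longrightarrow> S \<noteq> {} \<Longrightarrow>
      real (card {f \<in> F. f \<subseteq> S}) \<le> b * (real (card S) - 1)"
  shows "real (\<Sum>f\<in>F. card {t \<in> {1..n a\<^sub>0}. \<forall>a\<in>f. t \<le> n a}) \<le> b * (real (sum n A) - real (n a\<^sub>0))"
proof -
  let ?T = "{1..n a\<^sub>0}" and ?S = "\<lambda>t. {a \<in> A. t \<le> n a}"
  have "(\<Sum>f\<in>F. card {t \<in> ?T. \<forall>a\<in>f. t \<le> n a}) = (\<Sum>t\<in>?T. card {f \<in> F. \<forall>a\<in>f. t \<le> n a})"
    using F(1) by (intro sum_multicount_gen) auto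
  also have "\<dots> = (\<Sum>t\<in>?T. card {f \<in> F. f \<subseteq> ?S t})"
    using F(2) by (intro sum.cong refl arg_cong[where f = card]) blast
  finally have "real (\<Sum>f\<in>F. card {t \<in> ?T. \<forall>a\<in>f. t \<le> n a}) =
      (\<Sum>t\<in>?T. real (card {f \<in> F. f \<subseteq> ?S t}))" by simp
  \<comment> \<open>No level set is empty, as \<open>t\<close> runs only up to
    \<open>n a\<^sub>0\<close> and so \<open>a\<^sub>0\<close> belongs to all of them.\<close>
  also have "\<dots> \<le> (\<Sum>t\<in>?T. b * (real (card (?S t)) - 1))"
    using A by (intro sum_mono sparse) auto
  also have "\<dots> = b * (real (\<Sum>t\<in>?T. card (?S t)) - real (n a\<^sub>0))"
    by (simp add: sum_distrib_left[symmetric] sum_subtractf)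
  also have "(\<Sum>t\<in>?T. card (?S t)) = (\<Sum>a\<in>A. card {t \<in> ?T. t \<le> n a})"
    using A(1) by (intro sum_multicount_gen[symmetric]) auto
  also have "\<dots> = sum n A"
  proof (rule sum.cong[OF refl])
    fix a assume "a \<in> A"
    then have "{t \<in> ?T. t \<le> n a} = {1..n a}" using max by fastforce
    then show "card {t \<in> ?T. t \<le> n a} = n a" by simp
  qed
  finally show ?thesis .
qed

text \<open>An index other than \<open>a\<^sub>0\<close> has a value at most that of
  \<open>a\<^sub>0\<close>, hence at most half of the total, so its logarithm is smaller by at least
  1. Weighting this gain by \<open>n a\<close> and summing gives the total without
  \<open>n a\<^sub>0\<close>.\<close>

lemma sum_mult_log_le:
  fixes n :: "'a \<Rightarrow> nat"
  assumes A: "finite A" "a\<^sub>0 \<in> A" and pos: "\<And>a. a \<in> A \<Longrightarrow> n a > 0"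
    and max: "\<And>a. a \<in> A \<Longrightarrow> n a \<le> n a\<^sub>0"
  shows "(\<Sum>a\<in>A. real (n a) * log 2 (real (n a))) + (real (sum n A) - real (n a\<^sub>0))
           \<le> real (sum n A) * log 2 (real (sum n A))"
proof -
  define s where "s = sum n A"
  have bound: "real (n a) * (log 2 (real (n a)) + (if a = a\<^sub>0 then 0 else 1))
      \<le> real (n a) * log 2 (real s)" if a: "a \<in> A" for a
  proof (cases "a = a\<^sub>0")
    case True
    have "n a \<le> s" unfolding s_def using A(1) a by (intro member_le_sum) auto
    then show ?thesis using True pos[OF a] by (intro mult_left_mono) auto
  next
    case False
    have "n a + n a\<^sub>0 = sum n {a, a\<^sub>0}" using False by simp
    also have "\<dots> \<le> s" unfolding s_def using A a by (intro sum_mono2) auto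
    finally have le: "2 * n a \<le> s" using max[OF a] by simp
    have "log 2 (real (n a)) + 1 = log 2 (2 * real (n a))"
      using pos[OF a] by (simp add: log_mult)
    also have "\<dots> \<le> log 2 (real s)" using le pos[OF a] by (subst log_le_cancel_iff) linarith+
    finally show ?thesis using False by (intro mult_left_mono) auto
  qed
  have "sum n A = n a\<^sub>0 + sum n (A - {a\<^sub>0})" using A by (rule sum.remove)
  moreover have "(\<Sum>a\<in>A. real (n a) * (if a = a\<^sub>0 then 0 else 1)) = real (sum n (A - {a\<^sub>0}))"
    using A by (subst sum.remove[OF A]) simp_all
  ultimately have "(\<Sum>a\<in>A. real (n a) * log 2 (real (n a))) + (real s - real (n a\<^sub>0))
      = (\<Sum>a\<in>A. real (n a) * (log 2 (real (n a)) + (if a = a\<^sub>0 then 0 else 1)))"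
    by (simp add: s_def distrib_left sum.distrib)
  also have "\<dots> \<le> (\<Sum>a\<in>A. real (n a) * log 2 (real s))"
    by (intro sum_mono bound)
  also have "\<dots> = real s * log 2 (real s)" by (simp add: s_def sum_distrib_right)
  finally show ?thesis by (simp add: s_def)
qed

section \<open>Edges of the Cartesian product and their directions\<close>

lemma verts_cartesian_product: "verts (cartesian_product I Gs) = (\<Pi>\<^sub>E i\<in>I. verts (Gs i))"
  by (simp add: cartesian_product_def Let_def)

text \<open>Extensionality is recorded because it turns agreement on \<open>I\<close> away from
  \<open>j\<close> into agreement at every index other than \<open>j\<close>.\<close>

lemma cartesian_product_edgeE:
  assumes "e \<in> edges (cartesian_product I Gs)"
  obtains x y j where "e = {x, y}" "x \<in> extensional I" "y \<in> extensional I" "j \<in> I"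
    "{x j, y j} \<in> edges (Gs j)" "\<forall>i\<in>I. i \<noteq> j \<longrightarrow> x i = y i"
proof -
  from assms obtain x y j where "e = {x, y}" "j \<in> I" "{x j, y j} \<in> edges (Gs j)"
    "\<forall>i\<in>I. i \<noteq> j \<longrightarrow> x i = y i" "x \<in> (\<Pi>\<^sub>E i\<in>I. verts (Gs i))" "y \<in> (\<Pi>\<^sub>E i\<in>I. verts (Gs i))"
    unfolding cartesian_product_def Let_def ugraph.sel by blast
  then show ?thesis using that[of x y j] by (simp add: PiE_def)
qed

text \<open>The ends of an edge differ in a single coordinate, so a coordinate in which they differ
  must be its direction.\<close>

lemma cartesian_product_edge_direction:
  assumes "e \<in> edges (cartesian_product I Gs)" "i \<in> I" "x \<in> e" "y \<in> e" "x i \<noteq> y i"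
  shows "e = {x, y}" "{x i, y i} \<in> edges (Gs i)" "\<And>k. k \<noteq> i \<Longrightarrow> x k = y k"
proof -
  obtain u v j where e: "e = {u, v}" and ext: "u \<in> extensional I" "v \<in> extensional I"
    and j: "j \<in> I" "{u j, v j} \<in> edges (Gs j)" and eq: "\<forall>i\<in>I. i \<noteq> j \<longrightarrow> u i = v i"
    by (rule cartesian_product_edgeE[OF assms(1)])
  have xy: "x = u \<and> y = v \<or> x = v \<and> y = u" using assms(3-5) e by auto
  then have "i = j" using eq assms(2,5) by metis
  have "u k = v k" if "k \<noteq> j" for k
    using that eq ext by (cases "k \<in> I") (auto simp: extensional_def)
  with xy \<open>i = j\<close> show "x k = y k" if "k \<noteq> i" for k using that by metis
  show "e = {x, y}" using xy e by blast
  show "{x i, y i} \<in> edges (Gs i)" using xy j(2) \<open>i = j\<close> by (metis insert_commute)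
qed

text \<open>Factors have no loops, so the ends really differ in the direction of the edge. This
  supplies the coordinate along which the induction splits.\<close>

lemma cartesian_product_edge_proper:
  assumes "e \<in> edges (cartesian_product I Gs)" "\<And>i. i \<in> I \<Longrightarrow> simple_graph (Gs i)"
  obtains x y j where "e = {x, y}" "j \<in> I" "x j \<noteq> y j"
proof -
  obtain x y j where e: "e = {x, y}" "j \<in> I" "{x j, y j} \<in> edges (Gs j)"
    by (rule cartesian_product_edgeE[OF assms(1)])
  then have "card {x j, y j} = 2" using assms(2) by (auto simp: simple_graph_def)
  then have "x j \<noteq> y j" by (auto simp: card_2_iff)
  then show ?thesis by (rule that[OF e(1,2)])
qed

text \<open>The edges over \<open>f\<close> form a matching between the two fibres, so each of them is determined by
  its end in the fibre over \<open>a\<close>.\<close>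

lemma card_edges_over_le:
  assumes V: "finite V" and i: "i \<in> I" and f: "card f = 2" "a \<in> f"
  shows "card {e \<in> edges (cartesian_product I Gs). e \<subseteq> V \<and> (\<lambda>x. x i) ` e = f}
      \<le> card {x \<in> V. x i = a}" (is "card ?C \<le> card ?Va")
proof -
  obtain b where b: "f = {a, b}" "a \<noteq> b" using f by (auto simp: card_2_iff)
  have ex: "\<exists>x y. e = {x, y} \<and> e \<subseteq> V \<and> x i = a \<and> y i = b \<and> (\<forall>k. k \<noteq> i \<longrightarrow> x k = y k)"
    if e: "e \<in> ?C" for e
  proof -
    have "a \<in> (\<lambda>x. x i) ` e" "b \<in> (\<lambda>x. x i) ` e" using e b by auto
    then obtain x y where xy: "x \<in> e" "y \<in> e" "x i = a" "y i = b" by auto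
    have "e \<in> edges (cartesian_product I Gs)" "e \<subseteq> V" using e by auto
    with cartesian_product_edge_direction[OF this(1) i xy(1,2)] xy b(2) show ?thesis by blast
  qed
  \<comment> \<open>Changing coordinate \<open>i\<close> from \<open>a\<close> to \<open>b\<close>
    recovers the other end. Some of these pairs may fail to be edges, but covering \<open>?C\<close>
    suffices.\<close>
  have "?C \<subseteq> (\<lambda>x. {x, x(i := b)}) ` ?Va"
  proof
    fix e assume "e \<in> ?C"
    from ex[OF this] obtain x y where xy: "e = {x, y}" "e \<subseteq> V" "x i = a" "y i = b"
      "\<forall>k. k \<noteq> i \<longrightarrow> x k = y k" by blast
    have "y = x(i := b)" using xy(4,5) by (simp add: fun_eq_iff)
    then show "e \<in> (\<lambda>x. {x, x(i := b)}) ` ?Va" using xy(1-3) by (intro image_eqI[of _ _ x]) auto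
  qed
  then show ?thesis using V by (intro surj_card_le) auto
qed

text \<open>Edges in direction \<open>i\<close> are sorted by the factor edge \<open>f\<close> below
  them. The matching bound holds at each end of \<open>f\<close>, so it gives the minimum of the two
  fibre sizes, which is what \<open>sum_levels_le\<close> sums up.\<close>

lemma card_crossing_edges_le:
  assumes V: "finite V" and i: "i \<in> I" and G: "simple_graph (Gs i)"
    and a0: "a\<^sub>0 \<in> (\<lambda>x. x i) ` V"
    and max: "\<And>a. a \<in> (\<lambda>x. x i) ` V \<Longrightarrow> card {x \<in> V. x i = a} \<le> card {x \<in> V. x i = a\<^sub>0}"
    and sparse: "\<And>S. S \<subseteq> (\<lambda>x. x i) ` V \<Longrightarrow> S \<noteq> {} \<Longrightarrow>
      real (card {e \<in> edges (Gs i). e \<subseteq> S}) \<le> b * (real (card S) - 1)"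
  shows "real (card {e \<in> edges (cartesian_product I Gs). e \<subseteq> V \<and> (\<lambda>x. x i) ` e \<in> edges (Gs i)})
      \<le> b * (real (card V) - real (card {x \<in> V. x i = a\<^sub>0}))"
proof -
  define A where "A = (\<lambda>x. x i) ` V"
  define F where "F = {f \<in> edges (Gs i). f \<subseteq> A}"
  define n where "n a = card {x \<in> V. x i = a}" for a
  define C where "C f = {e \<in> edges (cartesian_product I Gs). e \<subseteq> V \<and> (\<lambda>x. x i) ` e = f}" for f
  have fin: "finite A" "finite F"
    using V finite_edges[OF G] by (auto simp: A_def F_def)
  have finC: "finite (C f)" for f
    by (rule finite_subset[of _ "Pow V"]) (use V in \<open>auto simp: C_def\<close>)
  have "{e \<in> edges (cartesian_product I Gs). e \<subseteq> V \<and> (\<lambda>x. x i) ` e \<in> edges (Gs i)} \<subseteq> (\<Union>f\<in>F. C f)"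
    by (auto simp: C_def F_def A_def)
  then have "card {e \<in> edges (cartesian_product I Gs). e \<subseteq> V \<and> (\<lambda>x. x i) ` e \<in> edges (Gs i)}
      \<le> card (\<Union>f\<in>F. C f)" using fin finC by (intro card_mono) auto
  also have "\<dots> \<le> (\<Sum>f\<in>F. card (C f))" by (rule card_UN_le[OF fin(2)])
  also have "\<dots> \<le> (\<Sum>f\<in>F. card {t \<in> {1..n a\<^sub>0}. \<forall>a\<in>f. t \<le> n a})"
  proof (rule sum_mono)
    fix f assume f: "f \<in> F"
    then have two: "card f = 2" using G by (auto simp: F_def simple_graph_def)
    have le: "card (C f) \<le> n a" if "a \<in> f" for a
      unfolding C_def n_def by (rule card_edges_over_le[OF V i two that])
    \<comment> \<open>One end of \<open>f\<close> is enough to see that the cap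
      \<open>n a\<^sub>0\<close> on the thresholds cuts nothing off.\<close>
    obtain a where "a \<in> f" using two by fastforce
    then have "n a \<le> n a\<^sub>0" using f max by (auto simp: F_def A_def n_def)
    with le \<open>a \<in> f\<close> have "card (C f) \<le> n a\<^sub>0" by fastforce
    with le have "{1..card (C f)} \<subseteq> {t \<in> {1..n a\<^sub>0}. \<forall>a\<in>f. t \<le> n a}" by fastforce
    from card_mono[OF _ this] show "card (C f) \<le> card {t \<in> {1..n a\<^sub>0}. \<forall>a\<in>f. t \<le> n a}" by simp
  qed
  finally have "real (card {e \<in> edges (cartesian_product I Gs). e \<subseteq> V \<and> (\<lambda>x. x i) ` e \<in> edges (Gs i)})
      \<le> real (\<Sum>f\<in>F. card {t \<in> {1..n a\<^sub>0}. \<forall>a\<in>f. t \<le> n a})" by (rule of_nat_mono)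
  also have "\<dots> \<le> b * (real (sum n A) - real (n a\<^sub>0))"
  proof (rule sum_levels_le)
    fix S assume S: "S \<subseteq> A" "S \<noteq> {}"
    then have "{f \<in> F. f \<subseteq> S} = {e \<in> edges (Gs i). e \<subseteq> S}" by (auto simp: F_def)
    then show "real (card {f \<in> F. f \<subseteq> S}) \<le> b * (real (card S) - 1)"
      using sparse S by (simp add: A_def)
  qed (use fin a0 max in \<open>auto simp: A_def F_def n_def\<close>)
  \<comment> \<open>The fibres partition \<open>V\<close>; counting is summing the constant 1 fibre
    by fibre.\<close>
  also have "sum n A = card V"
    unfolding n_def using sum.group[OF V fin(1), of "\<lambda>x. x i" "\<lambda>_. 1 :: nat"]
    by (simp add: A_def flip: card_eq_sum)
  finally show ?thesis by (simp add: n_def)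
qed

section \<open>Induction over vertex sets of the product\<close>

text \<open>The sparsity condition speaks only of subsets of the projections of \<open>V\<close>, so
  it passes to every subset of \<open>V\<close> with the same \<open>b\<close>. This is what lets
  one constant serve throughout the induction.\<close>

lemma card_cartesian_product_edges_le:
  assumes G: "\<And>i. i \<in> I \<Longrightarrow> simple_graph (Gs i)" and b: "0 \<le> b"
    and "finite V" "V \<noteq> {}"
    and "\<And>i S. i \<in> I \<Longrightarrow> S \<subseteq> (\<lambda>x. x i) ` V \<Longrightarrow> S \<noteq> {} \<Longrightarrow>
      real (card {e \<in> edges (Gs i). e \<subseteq> S}) \<le> b * (real (card S) - 1)"
  shows "real (card {e \<in> edges (cartesian_product I Gs). e \<subseteq> V})
      \<le> b * (real (card V) * log 2 (real (card V)))"
  using assms(3-)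
proof (induction V rule: finite_psubset_induct)
  case (psubset V)
  define E where "E W = {e \<in> edges (cartesian_product I Gs). e \<subseteq> W}" for W
  have finE: "finite (E W)" if "finite W" for W
    by (rule finite_subset[of _ "Pow W"]) (use that in \<open>auto simp: E_def\<close>)
  show ?case
  \<comment> \<open>Without an edge the bound only has to be nonnegative, which covers a single
    vertex. An edge provides a coordinate taking two values on \<open>V\<close>.\<close>
  proof (cases "E V = {}")
    case True
    have "real (card V) \<ge> 1" using psubset.hyps psubset.prems(1) by (simp add: Suc_leI card_gt_0_iff)
    then have "0 \<le> b * (real (card V) * log 2 (real (card V)))"
      using b by (intro mult_nonneg_nonneg) auto
    then show ?thesis using True by (simp only: E_def card.empty of_nat_0)
  next
    case False
    then obtain e where e: "e \<in> edges (cartesian_product I Gs)" "e \<subseteq> V" by (auto simp: E_def)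
    obtain u v i where "e = {u, v}" and i: "i \<in> I" and neq: "u i \<noteq> v i"
      by (rule cartesian_product_edge_proper[OF e(1) G])
    with e(2) have uv: "u \<in> V" "v \<in> V" by auto
    define A where "A = (\<lambda>x. x i) ` V"
    define W where "W a = {x \<in> V. x i = a}" for a
    define n where "n a = card (W a)" for a
    have finA: "finite A" using psubset.hyps by (simp add: A_def)
    have finW: "finite (W a)" for a using psubset.hyps by (simp add: W_def)
    have "Max (n ` A) \<in> n ` A" using finA uv by (intro Max_in) (auto simp: A_def)
    then obtain a\<^sub>0 where a0: "a\<^sub>0 \<in> A" "n a\<^sub>0 = Max (n ` A)" by auto
    have max: "n a \<le> n a\<^sub>0" if "a \<in> A" for a using that finA by (simp add: a0)
    have pos: "n a > 0" if "a \<in> A" for a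
      using that finW by (auto simp: n_def A_def W_def card_gt_0_iff)
    have cardV: "card V = sum n A"
      using sum.group[OF psubset.hyps finA, of "\<lambda>x. x i" "\<lambda>_. 1 :: nat"]
      by (simp add: A_def n_def W_def flip: card_eq_sum)
    have IH: "real (card (E (W a))) \<le> b * (real (n a) * log 2 (real (n a)))" if a: "a \<in> A" for a
      unfolding E_def n_def
    proof (rule psubset.IH)
      \<comment> \<open>No fibre contains both ends of the chosen edge, so every fibre is a proper
        subset of \<open>V\<close>.\<close>
      have "u \<notin> W a \<or> v \<notin> W a" using neq by (auto simp: W_def)
      then show "W a \<subset> V" using uv by (auto simp: W_def)
      show "W a \<noteq> {}" using a by (auto simp: A_def W_def)
      fix k S assume "k \<in> I" "S \<subseteq> (\<lambda>x. x k) ` W a" "S \<noteq> {}"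
      then show "real (card {e \<in> edges (Gs k). e \<subseteq> S}) \<le> b * (real (card S) - 1)"
        by (intro psubset.prems(2)) (auto simp: W_def)
    qed
    define C where "C = {e \<in> edges (cartesian_product I Gs). e \<subseteq> V \<and> (\<lambda>x. x i) ` e \<in> edges (Gs i)}"
    \<comment> \<open>An edge stays inside a fibre if its ends agree at \<open>i\<close>, and
      otherwise lies over an edge of the factor \<open>Gs i\<close>.\<close>
    have "E V \<subseteq> (\<Union>a\<in>A. E (W a)) \<union> C"
    proof
      fix e assume "e \<in> E V"
      then have e: "e \<in> edges (cartesian_product I Gs)" "e \<subseteq> V" by (auto simp: E_def)
      obtain x y j where xy: "e = {x, y}" using cartesian_product_edgeE[OF e(1)] by metis
      show "e \<in> (\<Union>a\<in>A. E (W a)) \<union> C"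
      proof (cases "x i = y i")
        case True
        then show ?thesis using e xy by (auto simp: E_def A_def W_def)
      next
        case False
        then have "(\<lambda>x. x i) ` e \<in> edges (Gs i)"
          using cartesian_product_edge_direction(2)[OF e(1) i, of x y] xy by simp
        then show ?thesis using e by (simp add: C_def)
      qed
    qed
    moreover have "finite C"
      by (rule finite_subset[OF _ finE[OF psubset.hyps]]) (auto simp: C_def E_def)
    ultimately have "card (E V) \<le> card ((\<Union>a\<in>A. E (W a)) \<union> C)"
      using finA finE[OF finW] by (intro card_mono) auto
    also have "\<dots> \<le> card (\<Union>a\<in>A. E (W a)) + card C" by (rule card_Un_le)
    also have "\<dots> \<le> (\<Sum>a\<in>A. card (E (W a))) + card C" by (intro add_right_mono card_UN_le finA)
    finally have "real (card (E V)) \<le> real ((\<Sum>a\<in>A. card (E (W a))) + card C)"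
      by (rule of_nat_mono)
    also have "\<dots> = (\<Sum>a\<in>A. real (card (E (W a)))) + real (card C)" by simp
    also have "\<dots> \<le> (\<Sum>a\<in>A. b * (real (n a) * log 2 (real (n a)))) +
        b * (real (card V) - real (n a\<^sub>0))"
    proof (intro add_mono sum_mono IH)
      show "real (card C) \<le> b * (real (card V) - real (n a\<^sub>0))"
        unfolding C_def n_def W_def
        using psubset.hyps i G[OF i] a0(1) max psubset.prems(2)[OF i]
        by (intro card_crossing_edges_le) (auto simp: A_def n_def W_def)
    qed
    also have "\<dots> = b * ((\<Sum>a\<in>A. real (n a) * log 2 (real (n a))) + (real (sum n A) - real (n a\<^sub>0)))"
      by (simp add: cardV sum_distrib_left distrib_left)
    also have "\<dots> \<le> b * (real (sum n A) * log 2 (real (sum n A)))"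
      by (intro mult_left_mono sum_mult_log_le finA a0(1) pos max b)
    finally show ?thesis by (simp add: E_def cardV)
  qed
qed

section \<open>From vertex sets to subgraphs and the ceilings of \<open>mad\<close>\<close>

theorem theorem4p1:
  fixes m :: nat
    and Gs :: "nat \<Rightarrow> 'a ugraph"
    and G :: "(nat \<Rightarrow> 'a) ugraph"
    and \<beta> \<beta>\<^sub>0 :: int
  assumes "m \<ge> 1"
    and "\<And>i. i \<in> {1..m} \<Longrightarrow> simple_graph (Gs i)"
    and "\<And>i. i \<in> {1..m} \<Longrightarrow> connected_graph (Gs i)"
    and "subgraph G (cartesian_product {1..m} Gs)"
    and "verts G \<noteq> {}"
    and "\<beta> = \<lceil>Max ((\<lambda>i. mad (Gs i)) ` {1..m})\<rceil>"
    and "\<beta>\<^sub>0 = \<lceil>Max ((\<lambda>i. mad (projection Gs i G)) ` {1..m})\<rceil>"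
  shows "real (card (edges G)) / real (card (verts G))
           \<le> real_of_int \<beta>\<^sub>0 * log 2 (real (card (verts G)))
       \<and> real_of_int \<beta>\<^sub>0 * log 2 (real (card (verts G)))
           \<le> real_of_int \<beta> * log 2 (real (card (verts G)))"
proof -
  let ?V = "verts G" and ?I = "{1..m}"
  have simple: "simple_graph G" using assms(4) by (simp add: subgraph_def)
  then have fin: "finite ?V" by (simp add: simple_graph_def)
  with assms(5) have card_pos: "real (card ?V) \<ge> 1" by (simp add: Suc_leI card_gt_0_iff)
  have V: "?V \<subseteq> (\<Pi>\<^sub>E i\<in>?I. verts (Gs i))"
    using assms(4) by (simp add: subgraph_def verts_cartesian_product)
  have proj_sub: "subgraph (projection Gs i G) (Gs i)" if "i \<in> ?I" for i
    unfolding projection_def by (rule subgraph_induced_subgraph[OF assms(2)[OF that]])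
  have proj_verts: "verts (projection Gs i G) = (\<lambda>x. x i) ` ?V" if "i \<in> ?I" for i
    using PiE_mem[OF subsetD[OF V] that] by (auto simp: projection_def)
  have proj_simple: "simple_graph (projection Gs i G)" if "i \<in> ?I" for i
    using proj_sub[OF that] by (simp add: subgraph_def)
  have mad_le: "mad (projection Gs i G) \<le> \<beta>\<^sub>0" if "i \<in> ?I" for i
  proof -
    have "mad (projection Gs i G) \<le> Max ((\<lambda>i. mad (projection Gs i G)) ` ?I)"
      using that by (intro Max_ge) auto
    then show ?thesis unfolding assms(7) by linarith
  qed
  \<comment> \<open>Any one factor shows that \<open>\<beta>\<^sub>0\<close> is nonnegative; index 1
    exists as \<open>m\<close> is at least 1.\<close>
  have "1 \<in> ?I" using assms(1) by simp
  have "0 \<le> mad (projection Gs 1 G)"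
    using assms(5) proj_verts[OF \<open>1 \<in> ?I\<close>] by (intro mad_nonneg proj_simple \<open>1 \<in> ?I\<close>) simp
  with mad_le[OF \<open>1 \<in> ?I\<close>] have b0: "0 \<le> real_of_int \<beta>\<^sub>0" by linarith
  \<comment> \<open>\<open>G\<close> need not be induced, so it is compared with all product edges
    inside its vertex set.\<close>
  have "card (edges G) \<le> card {e \<in> edges (cartesian_product ?I Gs). e \<subseteq> ?V}"
  proof (rule card_mono)
    show "finite {e \<in> edges (cartesian_product ?I Gs). e \<subseteq> ?V}"
      by (rule finite_subset[of _ "Pow ?V"]) (use fin in auto)
    show "edges G \<subseteq> {e \<in> edges (cartesian_product ?I Gs). e \<subseteq> ?V}"
      using assms(4) by (auto simp: subgraph_def simple_graph_def)
  qed
  then have "real (card (edges G)) \<le> real (card {e \<in> edges (cartesian_product ?I Gs). e \<subseteq> ?V})"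
    by simp
  also have "\<dots> \<le> \<beta>\<^sub>0 * (real (card ?V) * log 2 (real (card ?V)))"
  proof (rule card_cartesian_product_edges_le[OF assms(2) b0 fin assms(5)])
    fix i S assume i: "i \<in> ?I" and S: "S \<subseteq> (\<lambda>x. x i) ` ?V" "S \<noteq> {}"
    \<comment> \<open>Since projections are induced subgraphs, a set of projected values spans the
      same edges there as in the whole factor. Hence \<open>\<beta>\<^sub>0\<close>, and not just
      \<open>\<beta>\<close>, controls the count.\<close>
    have "{e \<in> edges (Gs i). e \<subseteq> S} = {e \<in> edges (projection Gs i G). e \<subseteq> S}"
      using S by (auto simp: projection_def)
    then have "real (card {e \<in> edges (Gs i). e \<subseteq> S})
        \<le> mad (projection Gs i G) * (real (card S) - 1)"
      using card_induced_edges_le[OF proj_simple[OF i], of S] S by (simp add: proj_verts[OF i])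
    also have "\<dots> \<le> \<beta>\<^sub>0 * (real (card S) - 1)"
    proof (rule mult_right_mono[OF mad_le[OF i]])
      have "finite S" using S(1) fin by (auto intro: finite_subset)
      then show "0 \<le> real (card S) - 1" using S(2) by (simp add: Suc_leI card_gt_0_iff)
    qed
    finally show "real (card {e \<in> edges (Gs i). e \<subseteq> S}) \<le> \<beta>\<^sub>0 * (real (card S) - 1)" .
  qed auto
  finally have "real (card (edges G)) / real (card ?V) \<le> \<beta>\<^sub>0 * log 2 (real (card ?V))"
    using card_pos by (simp add: field_simps)
  moreover have "\<beta>\<^sub>0 \<le> \<beta>"
    unfolding assms(6,7)
  proof (intro ceiling_mono Max.boundedI; clarsimp?)
    fix i assume "Suc 0 \<le> i" "i \<le> m"
    then have i: "i \<in> ?I" by simp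
    have "mad (projection Gs i G) \<le> mad (Gs i)"
      using assms(5) proj_verts[OF i] by (intro mad_mono assms(2) proj_sub i) simp
    also have "\<dots> \<le> Max ((\<lambda>i. mad (Gs i)) ` ?I)" using i by (intro Max_ge) auto
    finally show "mad (projection Gs i G) \<le> Max ((\<lambda>i. mad (Gs i)) ` {Suc 0..m})" by simp
  qed (use assms(1) in auto)
  \<comment> \<open>The logarithm is nonnegative because \<open>G\<close> has a vertex.\<close>
  then have "\<beta>\<^sub>0 * log 2 (real (card ?V)) \<le> \<beta> * log 2 (real (card ?V))"
    using card_pos by (intro mult_right_mono) auto
  ultimately show ?thesis by simp
qed

end
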